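(* For every valuation $v$ and every negation normal form $A$: the formula $\mathrm{CNFtoPropF}(\mathrm{MakeCNF}(A))$ has the same truth value under $v$ as $\mathrm{NNFtoPropF}(A)$.
   Context: Fix a set $V$ of propositional variables with decidable equality. Formulas are generated by $\#p$ ($p\in V$), $\bot$, $A\wedge B$, $A\vee B$, $A\to B$; $\neg A:=A\to\bot$, $\top:=\neg\bot$. A valuation is $v:V\to\{\mathrm{true},\mathrm{false}\}$, with truth of formulas defined by the usual boolean clauses ($\bot$ false, $A\to B$ true iff $A$ false or $B$ true). The type NNF is generated by $\mathrm{NPos}(p)$, $\mathrm{NNeg}(p)$ ($p\in V$), $\mathrm{NBot}$, $\mathrm{NTop}$, $\mathrm{NConj}(X,Y)$, $\mathrm{NDisj}(X,Y)$; $\mathrm{NNFtoPropF}$ sends these to $\#p$, $\neg\#p$, $\bot$, $\top$, $X'\wedge Y'$, $X'\vee Y'$ respectively. Literals are $\mathrm{LPos}(p)$, $\mathrm{LNeg}(p)$ ($p\in V$), $\mathrm{LBot}$, $\mathrm{LTop}$, mapped to formulas $\#p,\neg\#p,\bot,\top$. A clause is a finite list of literals and a CNF is a finite list of clauses. $\mathrm{ClausetoPropF}([\,])=\bot$, $\mathrm{ClausetoPropF}(l::c)=l'\vee\mathrm{ClausetoPropF}(c)$ ($l'$ the formula of literal $l$); $\mathrm{CNFtoPropF}([\,])=\top$, $\mathrm{CNFtoPropF}(c::ll)=\mathrm{ClausetoPropF}(c)\wedge\mathrm{CNFtoPropF}(ll)$. For a clause $c$ and CNF $ll$, $\mathrm{AddClause}(c,ll)$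 is the list obtained by replacing each clause $c_2$ of $ll$ by the concatenation $c\mathbin{++}c_2$; $\mathrm{Disjunct}(ll_1,ll_2)$ is the concatenation, over the clauses $c$ of $ll_1$ in order, of $\mathrm{AddClause}(c,ll_2)$. $\mathrm{MakeCNF}$ from NNF to CNF: $\mathrm{NPos}(p)\mapsto[[\mathrm{LPos}(p)]]$, $\mathrm{NNeg}(p)\mapsto[[\mathrm{LNeg}(p)]]$, $\mathrm{NBot}\mapsto[[\mathrm{LBot}]]$, $\mathrm{NTop}\mapsto[[\mathrm{LTop}]]$, $\mathrm{NConj}(B,C)\mapsto\mathrm{MakeCNF}(B)\mathbin{++}\mathrm{MakeCNF}(C)$, $\mathrm{NDisj}(B,C)\mapsto\mathrm{Disjunct}(\mathrm{MakeCNF}(B),\mathrm{MakeCNF}(C))$. *)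

theory Defs
  imports Main
begin

datatype 'v PropF =
    Var 'v
  | Bot
  | Conj "'v PropF" "'v PropF"
  | Disj "'v PropF" "'v PropF"
  | Impl "'v PropF" "'v PropF"

definition Neg :: "'v PropF \<Rightarrow> 'v PropF" where
  "Neg A = Impl A Bot"

definition Top :: "'v PropF" where
  "Top = Neg Bot"

primrec TrueQ :: "('v \<Rightarrow> bool) \<Rightarrow> 'v PropF \<Rightarrow> bool" where
  "TrueQ v (Var p) = v p"
| "TrueQ v Bot = False"
| "TrueQ v (Conj A B) = (TrueQ v A \<and> TrueQ v B)"
| "TrueQ v (Disj A B) = (TrueQ v A \<or> TrueQ v B)"
| "TrueQ v (Impl A B) = (\<not> TrueQ v A \<or> TrueQ v B)"

datatype 'v NNF =
    NPos 'v
  | NNeg 'v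
  | NBot
  | NTop
  | NConj "'v NNF" "'v NNF"
  | NDisj "'v NNF" "'v NNF"

primrec NNFtoPropF :: "'v NNF \<Rightarrow> 'v PropF" where
  "NNFtoPropF (NPos p) = Var p"
| "NNFtoPropF (NNeg p) = Neg (Var p)"
| "NNFtoPropF NBot = Bot"
| "NNFtoPropF NTop = Top"
| "NNFtoPropF (NConj X Y) = Conj (NNFtoPropF X) (NNFtoPropF Y)"
| "NNFtoPropF (NDisj X Y) = Disj (NNFtoPropF X) (NNFtoPropF Y)"

datatype 'v Literal =
    LPos 'v
  | LNeg 'v
  | LBot
  | LTop

primrec LiteraltoPropF :: "'v Literal \<Rightarrow> 'v PropF" where
  "LiteraltoPropF (LPos p) = Var p"
| "LiteraltoPropF (LNeg p) = Neg (Var p)"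
| "LiteraltoPropF LBot = Bot"
| "LiteraltoPropF LTop = Top"

type_synonym 'v Clause = "'v Literal list"
type_synonym 'v CNF = "'v Clause list"

primrec ClausetoPropF :: "'v Clause \<Rightarrow> 'v PropF" where
  "ClausetoPropF [] = Bot"
| "ClausetoPropF (l # c) = Disj (LiteraltoPropF l) (ClausetoPropF c)"

primrec CNFtoPropF :: "'v CNF \<Rightarrow> 'v PropF" where
  "CNFtoPropF [] = Top"
| "CNFtoPropF (c # ll) = Conj (ClausetoPropF c) (CNFtoPropF ll)"

definition AddClause :: "'v Clause \<Rightarrow> 'v CNF \<Rightarrow> 'v CNF" where
  "AddClause c ll = map (\<lambda>c2. c @ c2) ll"

definition Disjunct :: "'v CNF \<Rightarrow> 'v CNF \<Rightarrow> 'v CNF" where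
  "Disjunct ll1 ll2 = concat (map (\<lambda>c. AddClause c ll2) ll1)"

primrec MakeCNF :: "'v NNF \<Rightarrow> 'v CNF" where
  "MakeCNF (NPos p) = [[LPos p]]"
| "MakeCNF (NNeg p) = [[LNeg p]]"
| "MakeCNF NBot = [[LBot]]"
| "MakeCNF NTop = [[LTop]]"
| "MakeCNF (NConj B C) = MakeCNF B @ MakeCNF C"
| "MakeCNF (NDisj B C) = Disjunct (MakeCNF B) (MakeCNF C)"

end

theory Submission
  imports Defs
begin

text \<open>Appending lists acts as disjunction on clauses and as conjunction on CNFs. In the
  structural induction only \<open>NDisj\<close> has real content: disjunction distributes over
  finite conjunctions, used once per argument in \<open>TrueQ_AddClause\<close> and
  \<open>TrueQ_Disjunct\<close>.\<close>

lemma TrueQ_Neg [simp]: "TrueQ v (Neg A) \<longleftrightarrow> \<not> TrueQ v A"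
  by (simp add: Neg_def)

lemma TrueQ_Top [simp]: "TrueQ v Top"
  by (simp add: Top_def)

lemma TrueQ_ClausetoPropF_append [simp]:
  "TrueQ v (ClausetoPropF (c @ d)) \<longleftrightarrow> TrueQ v (ClausetoPropF c) \<or> TrueQ v (ClausetoPropF d)"
  by (induction c) auto

lemma TrueQ_CNFtoPropF_append [simp]:
  "TrueQ v (CNFtoPropF (ll1 @ ll2)) \<longleftrightarrow> TrueQ v (CNFtoPropF ll1) \<and> TrueQ v (CNFtoPropF ll2)"
  by (induction ll1) auto

text \<open>Distributivity over the clauses of \<open>ll\<close>; for empty \<open>ll\<close> both
  sides are true, the empty conjunction being \<open>Top\<close>.\<close>

lemma TrueQ_AddClause [simp]:
  "TrueQ v (CNFtoPropF (AddClause c ll)) \<longleftrightarrow> TrueQ v (ClausetoPropF c) \<or> TrueQ v (CNFtoPropF ll)"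
  by (induction ll) (auto simp: AddClause_def)

text \<open>Each clause of \<open>ll1\<close> contributes its disjunction with all of
  \<open>ll2\<close>; this common disjunct factors out.\<close>

lemma TrueQ_Disjunct [simp]:
  "TrueQ v (CNFtoPropF (Disjunct ll1 ll2)) \<longleftrightarrow> TrueQ v (CNFtoPropF ll1) \<or> TrueQ v (CNFtoPropF ll2)"
  by (induction ll1) (auto simp: Disjunct_def)

theorem mainTheorem4:
  fixes v :: "'v \<Rightarrow> bool" and A :: "'v NNF"
  shows "TrueQ v (CNFtoPropF (MakeCNF A)) = TrueQ v (NNFtoPropF A)"
  by (induction A) auto

end
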